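(* Let $N,d\ge 1$ be integers, $\gamma>0$, $\beta>0$, $\bar\psi\in\mathbb{R}^d$, and let $P:\mathbb{R}^d\times\mathbb{R}^d\to\mathbb{R}$ be continuously differentiable with $P(0,0)=0$ and $\|P\|:=\sup|P|<\infty$. Put $$\tilde D_0:=\frac1\beta\left[\frac1\gamma+2\left(\beta^2+2\beta\|P\|+2\|P\|^2\right)\right].$$ Then: (1) (uniform cheap control) For all $h\in(0,\frac1\beta)$, all $t_0\in\mathbb{R}$, all $\psi^0\in\mathbb{R}^{N\times d}$ and all $T>t_0$ with $(T-t_0)/h\in\mathbb{N}$, $$v_N^{(h,t_0,T)}(\psi^0)\le 2\tilde D_0\,\frac{\gamma}{2N}\,\|\psi^0-\psi^{(\sigma)}\|_N^2 .$$ (2) (uniform turnpike property) For every $t_0\in\mathbb{R}$ and $\psi^0\in\mathbb{R}^{N\times d}$ there exist constants $\tilde C_1>0$, $\lambda\in(0,1)$ and a strictly increasing function $\alpha:[0,\infty)\to[0,\infty)$ with $\alpha(0)=0$, all independent of $h$ and $T$, such that for all $h\in(0,\frac1\beta)$ and all $T>t_0$ with $M:=(T-t_0)/h\in\mathbb{N}$, every optimal state-control pair $(\psi,u)$ of $Q(t_0,T,h,N,\psi^0)$ satisfies $$\sum_{i=\lfloor(1-\lambda)M\rfloor}^{M-1}h\,\alpha\!\left(\|\psi^i-\psi^{(\sigma)}\|_N+\|u^i-u^{(\sigma)}\|_N\right)\le\tilde C_1 .$$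
   Context: For $x=(x_1,\dots,x_N)\in\mathbb{R}^{N\times d}$ put $\|x\|_N^2:=\sum_{k=1}^N\|x_k\|^2$ with $\|\cdot\|$ the Euclidean norm on $\mathbb{R}^d$; $\bar\psi\in\mathbb{R}^d$ is identified with $(\bar\psi,\dots,\bar\psi)\in\mathbb{R}^{N\times d}$ inside $\|\cdot\|_N$. With $M=(T-t_0)/h$, the dynamics with initial state $\psi^0$ and controls $u=(u^0,\dots,u^{M-1})$, $u^i\in\mathbb{R}^{N\times d}$, are $$\psi_k^{i+1}=\psi_k^i+h\Big(\frac1N\sum_{l=1}^N P(\psi_k^i,\psi_l^i)(\psi_l^i-\psi_k^i)+u_k^i\Big),\quad i=0,\dots,M-1,\ k=1,\dots,N .$$ Problem $Q(t_0,T,h,N,\psi^0)$: minimize over $u$, subject to the dynamics, the cost $$J_N^{(h,t_0,T)}(\psi,u)=\sum_{i=0}^{M-1}\frac hN\left(\|\psi^i-\bar\psi\|_N^2+\gamma\|u^i\|_N^2\right);$$ $v_N^{(h,t_0,T)}(\psi^0)$ denotes its optimal (minimal) value, and an optimal state-control pair is a minimizing $u$ together with its associated states $\psi$. $(\psi^{(\sigma)},u^{(\sigma)})$ is the optimal solution of the static problem of minimizing $\frac1N(\|\psi^{(\sigma)}-\bar\psi\|_N^2+\gamma\|u^{(\sigma)}\|_N^2)$ subject to $\frac1N\sum_{l=1}^N\big(P(\psi_k^{(\sigma)},\psi_l^{(\sigma)})(\psi_l^{(\sigma)}-\psi_k^{(\sigma)})+u_k^{(\sigma)}\big)=0$ for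 all $k$; it is given by $\psi^{(\sigma)}_k=\bar\psi$, $u^{(\sigma)}_k=0$ for all $k$. *)

theory Defs
  imports "HOL-Analysis.Analysis"
begin

text \<open>
  A configuration of \<open>N\<close> agents in the \<open>d\<close>-dimensional Euclidean space is an element of
  \<^typ>\<open>real^'d^'n\<close>, with \<open>N = CARD('n)\<close> and \<open>d = CARD('d)\<close>; \<open>x $ k\<close> is the state of agent \<open>k\<close>,
  and \<^term>\<open>vec a\<close> is the configuration with all agents at \<open>a\<close>.
  The library norm on this type is the one of the problem:
\<close>

lemma norm_config_power2:
  fixes x :: "real^'d^'n"
  shows "(norm x)\<^sup>2 = (\<Sum>k\<in>UNIV. (norm (x $ k))\<^sup>2)"
  by (simp add: norm_vec_def L2_set_def sum_nonneg)

definition continuously_differentiable ::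
    "('a::real_normed_vector \<Rightarrow> 'b::real_normed_vector) \<Rightarrow> bool" where
  "continuously_differentiable f \<longleftrightarrow>
     (\<exists>f' :: 'a \<Rightarrow> ('a \<Rightarrow>\<^sub>L 'b).
        (\<forall>x. (f has_derivative blinfun_apply (f' x)) (at x)) \<and> continuous_on UNIV f')"

text \<open>The supremum is meaningful only for bounded \<open>P\<close>.\<close>

definition sup_abs :: "('a \<Rightarrow> real) \<Rightarrow> real" where
  "sup_abs P = (SUP z. \<bar>P z\<bar>)"

definition D0 :: "real \<Rightarrow> real \<Rightarrow> ((real^'d) \<times> (real^'d) \<Rightarrow> real) \<Rightarrow> real" where
  "D0 \<beta> \<gamma> P =
     1 / \<beta> * (1 / \<gamma> + 2 * (\<beta>\<^sup>2 + 2 * \<beta> * sup_abs P + 2 * (sup_abs P)\<^sup>2))"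

text \<open>Used only if \<open>(T - t0) / h\<close> is a natural number; the floor is then exact.\<close>

definition num_steps :: "real \<Rightarrow> real \<Rightarrow> real \<Rightarrow> nat" where
  "num_steps h t0 T = nat \<lfloor>(T - t0) / h\<rfloor>"

text \<open>
  States and controls are sequences indexed by \<^typ>\<open>nat\<close>. Only \<open>\<psi> 0, \<dots>, \<psi> M\<close> and
  \<open>u 0, \<dots>, u (M - 1)\<close> are constrained or enter the cost; all later entries are irrelevant.
\<close>

definition admissible ::
    "((real^'d) \<times> (real^'d) \<Rightarrow> real) \<Rightarrow> real \<Rightarrow> real \<Rightarrow> real \<Rightarrow> real^'d^'n \<Rightarrow>
     (nat \<Rightarrow> real^'d^'n) \<Rightarrow> (nat \<Rightarrow> real^'d^'n) \<Rightarrow> bool" where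
  "admissible P h t0 T \<psi>0 \<psi> u \<longleftrightarrow>
     \<psi> 0 = \<psi>0 \<and>
     (\<forall>i < num_steps h t0 T. \<forall>k.
        \<psi> (Suc i) $ k = \<psi> i $ k + h *\<^sub>R
          ((1 / real CARD('n)) *\<^sub>R
             (\<Sum>l\<in>UNIV. P (\<psi> i $ k, \<psi> i $ l) *\<^sub>R (\<psi> i $ l - \<psi> i $ k)) + u i $ k))"

definition cost ::
    "real \<Rightarrow> real^'d \<Rightarrow> real \<Rightarrow> real \<Rightarrow> real \<Rightarrow>
     (nat \<Rightarrow> real^'d^'n) \<Rightarrow> (nat \<Rightarrow> real^'d^'n) \<Rightarrow> real" where
  "cost \<gamma> \<psi>bar h t0 T \<psi> u =
     (\<Sum>i < num_steps h t0 T.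
        h / real CARD('n) * ((norm (\<psi> i - vec \<psi>bar))\<^sup>2 + \<gamma> * (norm (u i))\<^sup>2))"

definition optimal_value ::
    "((real^'d) \<times> (real^'d) \<Rightarrow> real) \<Rightarrow> real \<Rightarrow> real^'d \<Rightarrow> real \<Rightarrow> real \<Rightarrow> real \<Rightarrow>
     real^'d^'n \<Rightarrow> real" where
  "optimal_value P \<gamma> \<psi>bar h t0 T \<psi>0 =
     Inf {cost \<gamma> \<psi>bar h t0 T \<psi> u | \<psi> u. admissible P h t0 T \<psi>0 \<psi> u}"

definition optimal_pair ::
    "((real^'d) \<times> (real^'d) \<Rightarrow> real) \<Rightarrow> real \<Rightarrow> real^'d \<Rightarrow> real \<Rightarrow> real \<Rightarrow> real \<Rightarrow>
     real^'d^'n \<Rightarrow> (nat \<Rightarrow> real^'d^'n) \<Rightarrow> (nat \<Rightarrow> real^'d^'n) \<Rightarrow> bool" where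
  "optimal_pair P \<gamma> \<psi>bar h t0 T \<psi>0 \<psi> u \<longleftrightarrow>
     admissible P h t0 T \<psi>0 \<psi> u \<and>
     (\<forall>\<psi>' u'. admissible P h t0 T \<psi>0 \<psi>' u' \<longrightarrow>
        cost \<gamma> \<psi>bar h t0 T \<psi> u \<le> cost \<gamma> \<psi>bar h t0 T \<psi>' u')"

definition static_admissible ::
    "((real^'d) \<times> (real^'d) \<Rightarrow> real) \<Rightarrow> real^'d^'n \<Rightarrow> real^'d^'n \<Rightarrow> bool" where
  "static_admissible P \<psi> u \<longleftrightarrow>
     (\<forall>k. (1 / real CARD('n)) *\<^sub>R
        (\<Sum>l\<in>UNIV. P (\<psi> $ k, \<psi> $ l) *\<^sub>R (\<psi> $ l - \<psi> $ k) + u $ k) = 0)"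

definition static_cost :: "real \<Rightarrow> real^'d \<Rightarrow> real^'d^'n \<Rightarrow> real^'d^'n \<Rightarrow> real" where
  "static_cost \<gamma> \<psi>bar \<psi> u =
     1 / real CARD('n) * ((norm (\<psi> - vec \<psi>bar))\<^sup>2 + \<gamma> * (norm u)\<^sup>2)"

definition static_optimal ::
    "((real^'d) \<times> (real^'d) \<Rightarrow> real) \<Rightarrow> real \<Rightarrow> real^'d \<Rightarrow> real^'d^'n \<Rightarrow> real^'d^'n \<Rightarrow> bool" where
  "static_optimal P \<gamma> \<psi>bar \<psi> u \<longleftrightarrow>
     static_admissible P \<psi> u \<and>
     (\<forall>(\<psi>' :: real^'d^'n) (u' :: real^'d^'n). static_admissible P \<psi>' u' \<longrightarrow>
        static_cost \<gamma> \<psi>bar \<psi> u \<le> static_cost \<gamma> \<psi>bar \<psi>' u')"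

text \<open>The static problem has exactly one optimal solution, and it is the expected one.\<close>

lemma static_optimal_iff:
  fixes P :: "(real^'d) \<times> (real^'d) \<Rightarrow> real"
    and \<gamma> :: real and \<psi>bar :: "real^'d" and \<psi> u :: "real^'d^'n"
  assumes "\<gamma> > 0"
  shows "static_optimal P \<gamma> \<psi>bar \<psi> u \<longleftrightarrow> \<psi> = vec \<psi>bar \<and> u = 0"
proof
  assume *: "static_optimal P \<gamma> \<psi>bar \<psi> u"
  have "static_admissible P (vec \<psi>bar :: real^'d^'n) 0"
    by (simp add: static_admissible_def)
  with * have "static_cost \<gamma> \<psi>bar \<psi> u \<le> static_cost \<gamma> \<psi>bar (vec \<psi>bar :: real^'d^'n) 0"
    unfolding static_optimal_def by blast
  then have "(norm (\<psi> - vec \<psi>bar))\<^sup>2 + \<gamma> * (norm u)\<^sup>2 \<le> 0"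
    by (simp add: static_cost_def divide_le_0_iff)
  moreover have "(norm (\<psi> - vec \<psi>bar))\<^sup>2 \<ge> 0" "\<gamma> * (norm u)\<^sup>2 \<ge> 0"
    using assms by simp_all
  ultimately have "(norm (\<psi> - vec \<psi>bar))\<^sup>2 = 0" "\<gamma> * (norm u)\<^sup>2 = 0"
    by linarith+
  with assms show "\<psi> = vec \<psi>bar \<and> u = 0"
    by simp
next
  assume "\<psi> = vec \<psi>bar \<and> u = 0"
  with assms show "static_optimal P \<gamma> \<psi>bar \<psi> u"
    by (auto simp: static_optimal_def static_admissible_def static_cost_def)
qed

end

(*
  The feedback u = -\<beta>(\<psi> - \<psi>bar) - (interaction) cancels the interaction, so the closed loop is
  \<psi>^(i+1) - \<psi>bar = (1 - h\<beta>)(\<psi>^i - \<psi>bar). Its control is at most (\<beta> + 2 sup|P|) times the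
  deviation from \<psi>bar, and h times the sum of (1 - h\<beta>)^(2i) is at most 1/\<beta>, uniformly in h and T;
  this is the cheap control bound. The summands of the cost dominate a multiple of
  (|\<psi> - \<psi>bar| + |u|)^2, so the turnpike estimate holds with \<alpha>(s) = s^2 and any \<lambda>.
*)

theory Submission
  imports Defs
begin

definition interaction :: "((real^'d) \<times> (real^'d) \<Rightarrow> real) \<Rightarrow> real^'d^'n \<Rightarrow> real^'d^'n" where
  "interaction P x = (\<chi> k. (1 / real CARD('n)) *\<^sub>R
     (\<Sum>l\<in>UNIV. P (x $ k, x $ l) *\<^sub>R (x $ l - x $ k)))"

text \<open>Minkowski's inequality over the agents separates the two terms. The mean enters as the
  same number for every agent, so its L2 norm carries a factor sqrt N; Cauchy-Schwarz absorbs it,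
  and the resulting constant does not depend on N.\<close>

lemma norm_vec_le_affine:
  fixes x z :: "real^'d^'n"
  assumes "\<And>k. norm (z $ k) \<le> a * norm (x $ k) + c * ((\<Sum>l\<in>UNIV. norm (x $ l)) / real CARD('n))"
    and "0 \<le> a" "0 \<le> c"
  shows "norm z \<le> (a + c) * norm x"
proof -
  define m where "m = (\<Sum>l\<in>UNIV. norm (x $ l)) / real CARD('n)"
  have norm_L2: "norm w = L2_set (\<lambda>k. norm (w $ k)) UNIV" for w :: "real^'d^'n"
    by (rule norm_vec_def)
  have m0: "0 \<le> m"
    by (simp add: m_def sum_nonneg)
  \<comment> \<open>Cauchy-Schwarz for the sum of the N agent norms, which is
    \<open>real CARD('n) * m\<close>; cancelling one factor N below leaves
    \<open>sqrt N * m \<le> norm x\<close>.\<close>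
  have "(real CARD('n) * m)\<^sup>2 \<le> real CARD('n) * (norm x)\<^sup>2"
    using sum_squared_le_sum_of_squares[of "\<lambda>l. norm (x $ l)" UNIV]
    by (simp add: m_def norm_config_power2 mult.commute)
  then have "real CARD('n) * (real CARD('n) * m\<^sup>2) \<le> real CARD('n) * (norm x)\<^sup>2"
    by (simp only: power_mult_distrib power2_eq_square mult_ac)
  then have "real CARD('n) * m\<^sup>2 \<le> (norm x)\<^sup>2"
    by (rule mult_left_le_imp_le) simp
  then have mean: "sqrt (real CARD('n)) * m \<le> norm x"
    using power2_le_imp_le[of "sqrt (real CARD('n)) * m" "norm x"]
    by (simp add: power_mult_distrib)
  have "norm z \<le> L2_set (\<lambda>k. a * norm (x $ k) + c * m) UNIV"
    unfolding norm_L2 using assms(1) by (intro L2_set_mono) (simp_all add: m_def)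
  also have "\<dots> \<le> L2_set (\<lambda>k. a * norm (x $ k)) UNIV + L2_set (\<lambda>k::'n. c * m) UNIV"
    by (rule L2_set_triangle_ineq)
  also have "\<dots> = a * norm x + c * (sqrt (real CARD('n)) * m)"
    using assms(2,3) m0
    by (simp add: norm_L2 L2_set_right_distrib[symmetric])
       (simp add: L2_set_def real_sqrt_mult)
  also have "\<dots> \<le> a * norm x + c * norm x"
    using mean assms(3) by (simp add: mult_left_mono)
  finally show ?thesis
    by (simp add: algebra_simps)
qed

text \<open>The interaction contains only differences of states, so it can be estimated through
  deviations from any \<open>b\<close>. For each agent it costs \<open>p\<close> times its own
  deviation plus \<open>p\<close> times the mean deviation; each of the two contributes one
  \<open>p\<close> to the final constant.\<close>

lemma norm_feedback_le:
  fixes x :: "real^'d^'n" and b :: "real^'d"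
  assumes P_le: "\<And>z. \<bar>P z\<bar> \<le> p" and "0 \<le> \<beta>"
  shows "norm (\<beta> *\<^sub>R (x - vec b) + interaction P x) \<le> (\<beta> + 2 * p) * norm (x - vec b)"
proof -
  define y where "y = x - vec b"
  have "0 \<le> p"
    using P_le[of undefined] by linarith
  have "norm ((\<beta> *\<^sub>R y + interaction P x) $ k)
      \<le> (\<beta> + p) * norm (y $ k) + p * ((\<Sum>l\<in>UNIV. norm (y $ l)) / real CARD('n))" for k
  proof -
    have "norm (\<Sum>l\<in>UNIV. P (x $ k, x $ l) *\<^sub>R (x $ l - x $ k))
        \<le> (\<Sum>l\<in>UNIV. p * (norm (y $ l) + norm (y $ k)))"
    proof (rule sum_norm_le)
      fix l
      \<comment> \<open>The shift by \<open>b\<close> cancels in the difference.\<close>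
      have "norm (x $ l - x $ k) \<le> norm (y $ l) + norm (y $ k)"
        using norm_triangle_ineq4[of "y $ l" "y $ k"] by (simp add: y_def)
      then show "norm (P (x $ k, x $ l) *\<^sub>R (x $ l - x $ k)) \<le> p * (norm (y $ l) + norm (y $ k))"
        using P_le \<open>0 \<le> p\<close> by (simp add: mult_mono)
    qed
    also have "\<dots> = p * ((\<Sum>l\<in>UNIV. norm (y $ l)) + real CARD('n) * norm (y $ k))"
      by (simp add: sum_distrib_left[symmetric] sum.distrib)
    finally have "norm (interaction P x $ k)
        \<le> p * ((\<Sum>l\<in>UNIV. norm (y $ l)) + real CARD('n) * norm (y $ k)) / real CARD('n)"
      by (simp add: interaction_def divide_right_mono)
    also have "\<dots> = p * ((\<Sum>l\<in>UNIV. norm (y $ l)) / real CARD('n)) + p * norm (y $ k)"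
      by (simp add: field_simps)
    finally show ?thesis
      using norm_triangle_ineq[of "\<beta> *\<^sub>R y $ k" "interaction P x $ k"] \<open>0 \<le> \<beta>\<close>
      by (simp add: algebra_simps)
  qed
  from norm_vec_le_affine[OF this] \<open>0 \<le> p\<close> \<open>0 \<le> \<beta>\<close> show ?thesis
    by (simp add: y_def add.commute)
qed

text \<open>A geometric sum with ratio \<open>q\<close>, the square of
  \<open>1 - h * \<beta>\<close>. Since \<open>1 - h * \<beta>\<close> lies in (0,1), squaring only
  decreases it, so \<open>1 - q\<close> is at least \<open>h * \<beta>\<close>; the sum is at most
  \<open>1 / (h * \<beta>)\<close> and the step size cancels.\<close>

lemma sum_contraction_le:
  fixes h \<beta> :: real
  assumes "0 < h" "0 < \<beta>" "h * \<beta> < 1"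
  shows "h * (\<Sum>i<M. (1 - h * \<beta>) ^ (2 * i)) \<le> 1 / \<beta>"
proof -
  define q where "q = (1 - h * \<beta>)\<^sup>2"
  have pos: "0 < h * \<beta>"
    using assms by simp
  have "q \<le> 1 - h * \<beta>"
    using assms pos by (simp add: q_def power2_eq_square mult_left_le)
  then have q: "h * \<beta> \<le> 1 - q" "0 \<le> q"
    by (simp_all add: q_def)
  then have "(h * \<beta>) * (\<Sum>i<M. q ^ i) \<le> (1 - q) * (\<Sum>i<M. q ^ i)"
    by (intro mult_right_mono sum_nonneg) simp_all
  also have "\<dots> = 1 - q ^ M"
    by (simp add: sum_gp_basic one_diff_power_eq)
  also have "\<dots> \<le> 1"
    using q by simp
  finally have "h * (\<Sum>i<M. q ^ i) \<le> 1 / \<beta>"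
    using assms by (simp add: field_simps)
  then show ?thesis
    unfolding q_def power_mult .
qed

text \<open>The feedback pair itself is provided, not just a bound on the optimal value: it serves
  as a member of the set whose infimum is taken and as the competitor of an optimal pair.\<close>

lemma cheap_control:
  fixes P :: "(real^'d) \<times> (real^'d) \<Rightarrow> real" and \<psi>0 :: "real^'d^'n"
  assumes "0 < \<gamma>" "0 < \<beta>" "0 < h" "h < 1 / \<beta>"
    and P_bounded: "bdd_above (range (\<lambda>z. \<bar>P z\<bar>))"
  obtains \<psi> u where "admissible P h t0 T \<psi>0 \<psi> u"
    and "cost \<gamma> \<psi>bar h t0 T \<psi> u \<le> D0 \<beta> \<gamma> P * \<gamma> / real CARD('n) * (norm (\<psi>0 - vec \<psi>bar))\<^sup>2"
proof -
  define p where "p = sup_abs P"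
  have P_le: "\<bar>P z\<bar> \<le> p" for z
    unfolding p_def sup_abs_def by (rule cSUP_upper[OF _ P_bounded]) simp
  then have p0: "0 \<le> p"
    using abs_ge_zero order_trans by blast
  have h\<beta>: "h * \<beta> < 1"
    using assms by (simp add: field_simps)
  \<comment> \<open>The closed-loop trajectory is given by its explicit solution; the recursion is
    verified afterwards as \<open>step\<close>.\<close>
  define \<psi> where "\<psi> i = vec \<psi>bar + (1 - h * \<beta>) ^ i *\<^sub>R (\<psi>0 - vec \<psi>bar)" for i
  define u where "u i = - (\<beta> *\<^sub>R (\<psi> i - vec \<psi>bar) + interaction P (\<psi> i))" for i
  define M where "M = num_steps h t0 T"
  \<comment> \<open>\<open>K\<close> equals
    \<open>\<beta> * \<gamma> * D0 \<beta> \<gamma> P\<close>. It bounds the state and control cost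
    of one stage per squared deviation; the missing factor \<open>1 / \<beta>\<close> comes from the
    geometric sum.\<close>
  define K where "K = 1 + \<gamma> * (2 * (\<beta>\<^sup>2 + 2 * \<beta> * p + 2 * p\<^sup>2))"
  have "0 \<le> K"
    using assms p0 by (simp add: K_def)
  have step: "\<psi> (Suc i) = \<psi> i + h *\<^sub>R (interaction P (\<psi> i) + u i)" for i
    by (simp add: u_def \<psi>_def algebra_simps)
  have "admissible P h t0 T \<psi>0 \<psi> u"
    unfolding admissible_def
  proof (intro conjI allI impI)
    show "\<psi> 0 = \<psi>0"
      by (simp add: \<psi>_def)
  qed (simp add: step interaction_def)
  moreover have "cost \<gamma> \<psi>bar h t0 T \<psi> u
      \<le> D0 \<beta> \<gamma> P * \<gamma> / real CARD('n) * (norm (\<psi>0 - vec \<psi>bar))\<^sup>2"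
  proof -
    have term_le: "(norm (\<psi> i - vec \<psi>bar))\<^sup>2 + \<gamma> * (norm (u i))\<^sup>2
        \<le> K * (norm (\<psi>0 - vec \<psi>bar))\<^sup>2 * (1 - h * \<beta>) ^ (2 * i)" for i
    proof -
      have "norm (u i) \<le> (\<beta> + 2 * p) * norm (\<psi> i - vec \<psi>bar)"
        unfolding u_def norm_minus_cancel using P_le assms by (intro norm_feedback_le) simp_all
      then have "(norm (u i))\<^sup>2 \<le> ((\<beta> + 2 * p) * norm (\<psi> i - vec \<psi>bar))\<^sup>2"
        by (intro power_mono) simp_all
      \<comment> \<open>The square of \<open>\<beta> + 2 * p\<close> falls short of the factor on
        the right by exactly \<open>\<beta>\<^sup>2\<close>.\<close>
      also have "\<dots> \<le> (2 * (\<beta>\<^sup>2 + 2 * \<beta> * p + 2 * p\<^sup>2)) * (norm (\<psi> i - vec \<psi>bar))\<^sup>2"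
        unfolding power_mult_distrib
        by (intro mult_right_mono) (simp_all add: power2_eq_square algebra_simps)
      finally have "(norm (\<psi> i - vec \<psi>bar))\<^sup>2 + \<gamma> * (norm (u i))\<^sup>2 \<le> K * (norm (\<psi> i - vec \<psi>bar))\<^sup>2"
        using mult_left_mono[of _ _ \<gamma>] assms by (fastforce simp: K_def distrib_right mult.assoc)
      also have "\<dots> = K * (norm (\<psi>0 - vec \<psi>bar))\<^sup>2 * (1 - h * \<beta>) ^ (2 * i)"
        by (simp add: \<psi>_def power_mult_distrib power_abs[symmetric] power_even_eq)
      finally show ?thesis .
    qed
    have "cost \<gamma> \<psi>bar h t0 T \<psi> u
        \<le> (\<Sum>i<M. h / real CARD('n) * (K * (norm (\<psi>0 - vec \<psi>bar))\<^sup>2 * (1 - h * \<beta>) ^ (2 * i)))"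
      unfolding cost_def M_def using term_le assms by (intro sum_mono mult_left_mono) simp_all
    also have "\<dots> = K * (norm (\<psi>0 - vec \<psi>bar))\<^sup>2 / real CARD('n)
        * (h * (\<Sum>i<M. (1 - h * \<beta>) ^ (2 * i)))"
      by (simp add: sum_distrib_left mult_ac)
    also have "\<dots> \<le> K * (norm (\<psi>0 - vec \<psi>bar))\<^sup>2 / real CARD('n) * (1 / \<beta>)"
      using \<open>0 \<le> K\<close> assms h\<beta> by (intro mult_left_mono sum_contraction_le) simp_all
    also have "\<dots> = D0 \<beta> \<gamma> P * \<gamma> / real CARD('n) * (norm (\<psi>0 - vec \<psi>bar))\<^sup>2"
      using assms by (simp add: D0_def K_def p_def field_simps)
    finally show ?thesis .
  qed
  ultimately show thesis
    by (rule that)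
qed

text \<open>The square of a sum is at most twice the sum of squares, and the factor N undoes the
  averaging in the cost. Summands are nonnegative, so any set of stages is allowed, in particular
  the final stretch of the horizon.\<close>

lemma sum_power2_le_cost:
  fixes \<psi> u :: "nat \<Rightarrow> real^'d^'n"
  assumes "0 < \<gamma>" "0 < h" and sub: "I \<subseteq> {..<num_steps h t0 T}"
  shows "(\<Sum>i\<in>I. h * (norm (\<psi> i - vec \<psi>bar) + norm (u i))\<^sup>2)
    \<le> 2 * (1 + 1 / \<gamma>) * real CARD('n) * cost \<gamma> \<psi>bar h t0 T \<psi> u"
proof -
  have term_le: "h * (norm (\<psi> i - vec \<psi>bar) + norm (u i))\<^sup>2 \<le> 2 * (1 + 1 / \<gamma>) * real CARD('n) *
      (h / real CARD('n) * ((norm (\<psi> i - vec \<psi>bar))\<^sup>2 + \<gamma> * (norm (u i))\<^sup>2))" for i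
  proof -
    define a b where "a = norm (\<psi> i - vec \<psi>bar)" and "b = norm (u i)"
    have "(a + b)\<^sup>2 \<le> 2 * (a\<^sup>2 + b\<^sup>2)"
      using sum_squares_bound[of a b] by (simp add: power2_sum)
    \<comment> \<open>\<open>1 + 1 / \<gamma>\<close> dominates both 1 and
      \<open>1 / \<gamma>\<close>, which avoids a case split on the size of
      \<open>\<gamma>\<close>.\<close>
    also have "\<dots> \<le> 2 * (1 + 1 / \<gamma>) * (a\<^sup>2 + \<gamma> * b\<^sup>2)"
      using assms(1) by (simp add: field_simps)
    finally have "h * (a + b)\<^sup>2 \<le> h * (2 * (1 + 1 / \<gamma>) * (a\<^sup>2 + \<gamma> * b\<^sup>2))"
      using assms(2) by (simp add: mult_left_mono)
    then show ?thesis
      by (simp add: a_def b_def mult_ac)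
  qed
  have "(\<Sum>i\<in>I. h * (norm (\<psi> i - vec \<psi>bar) + norm (u i))\<^sup>2)
      \<le> (\<Sum>i<num_steps h t0 T. h * (norm (\<psi> i - vec \<psi>bar) + norm (u i))\<^sup>2)"
    using sub assms(2) by (intro sum_mono2) simp_all
  also have "\<dots> \<le> 2 * (1 + 1 / \<gamma>) * real CARD('n) * cost \<gamma> \<psi>bar h t0 T \<psi> u"
    unfolding cost_def sum_distrib_left using term_le by (intro sum_mono)
  finally show ?thesis .
qed

theorem mainTheorem4:
  fixes P :: "(real^'d) \<times> (real^'d) \<Rightarrow> real"
    and \<beta> \<gamma> :: real
    and \<psi>bar :: "real^'d"
    and \<psi>\<sigma> u\<sigma> :: "real^'d^'n"
  assumes gamma_pos: "\<gamma> > 0"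
    and beta_pos: "\<beta> > 0"
    and P_C1: "continuously_differentiable P"
    and P_zero: "P (0, 0) = 0"
    and P_bounded: "bdd_above (range (\<lambda>z. \<bar>P z\<bar>))"
    and static: "static_optimal P \<gamma> \<psi>bar \<psi>\<sigma> u\<sigma>"
  shows
    "(\<forall>(h::real) (t0::real) (\<psi>0 :: real^'d^'n) (T::real).
        0 < h \<and> h < 1 / \<beta> \<and> t0 < T \<and> (T - t0) / h \<in> \<nat> \<longrightarrow>
          optimal_value P \<gamma> \<psi>bar h t0 T \<psi>0
            \<le> 2 * D0 \<beta> \<gamma> P * (\<gamma> / (2 * real CARD('n))) * (norm (\<psi>0 - \<psi>\<sigma>))\<^sup>2)
     \<and>
     (\<forall>(t0::real) (\<psi>0 :: real^'d^'n).
        \<exists>(C1::real) (lam::real) (\<alpha> :: real \<Rightarrow> real).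
          0 < C1 \<and> 0 < lam \<and> lam < 1 \<and>
          \<alpha> \<in> {0..} \<rightarrow> {0..} \<and> strict_mono_on {0..} \<alpha> \<and> \<alpha> 0 = 0 \<and>
          (\<forall>(h::real) (T::real).
             0 < h \<and> h < 1 / \<beta> \<and> t0 < T \<and> (T - t0) / h \<in> \<nat> \<longrightarrow>
             (\<forall>\<psi> u. optimal_pair P \<gamma> \<psi>bar h t0 T \<psi>0 \<psi> u \<longrightarrow>
                (\<Sum>i = nat \<lfloor>(1 - lam) * real (num_steps h t0 T)\<rfloor>..<num_steps h t0 T.
                   h * \<alpha> (norm (\<psi> i - \<psi>\<sigma>) + norm (u i - u\<sigma>))) \<le> C1)))"
proof (intro conjI allI impI)
  have \<sigma>: "\<psi>\<sigma> = vec \<psi>bar" "u\<sigma> = 0"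
    using static static_optimal_iff[OF gamma_pos] by auto
  {
    fix h t0 T :: real and \<psi>0 :: "real^'d^'n"
    assume "0 < h \<and> h < 1 / \<beta> \<and> t0 < T \<and> (T - t0) / h \<in> \<nat>"
    then have h: "0 < h" "h < 1 / \<beta>"
      by auto
    obtain \<psi> u :: "nat \<Rightarrow> real^'d^'n" where adm: "admissible P h t0 T \<psi>0 \<psi> u"
      and le: "cost \<gamma> \<psi>bar h t0 T \<psi> u
        \<le> D0 \<beta> \<gamma> P * \<gamma> / real CARD('n) * (norm (\<psi>0 - vec \<psi>bar))\<^sup>2"
      by (rule cheap_control[OF gamma_pos beta_pos h P_bounded])
    \<comment> \<open>Costs are nonnegative, so the real infimum is a genuine lower bound of the
      set.\<close>
    have "bdd_below {cost \<gamma> \<psi>bar h t0 T \<psi> u | \<psi> u. admissible P h t0 T \<psi>0 \<psi> u}"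
      using gamma_pos h by (intro bdd_belowI[of _ 0]) (auto simp: cost_def intro!: sum_nonneg)
    then have "optimal_value P \<gamma> \<psi>bar h t0 T \<psi>0 \<le> cost \<gamma> \<psi>bar h t0 T \<psi> u"
      unfolding optimal_value_def using adm by (intro cInf_lower) blast+
    with le show "optimal_value P \<gamma> \<psi>bar h t0 T \<psi>0
        \<le> 2 * D0 \<beta> \<gamma> P * (\<gamma> / (2 * real CARD('n))) * (norm (\<psi>0 - \<psi>\<sigma>))\<^sup>2"
      by (simp add: \<sigma>)
  }
  fix t0 :: real and \<psi>0 :: "real^'d^'n"
  \<comment> \<open>\<open>A\<close> converts cost into the turnpike sum and \<open>B\<close> bounds
    the optimal cost. Neither involves \<open>h\<close> or \<open>T\<close>, so the constant can be
    chosen before both.\<close>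
  define A where "A = 2 * (1 + 1 / \<gamma>) * real CARD('n)"
  define B where "B = D0 \<beta> \<gamma> P * \<gamma> / real CARD('n) * (norm (\<psi>0 - vec \<psi>bar))\<^sup>2"
  have "0 \<le> A"
    using gamma_pos by (simp add: A_def)
  let ?\<alpha> = "\<lambda>s::real. s\<^sup>2"
  \<comment> \<open>\<open>B\<close> vanishes when \<psi>0 is already the static optimum, so 1 is
    added to make the constant strictly positive; the absolute value makes this independent of the
    sign of the product. The choice 1/2 is arbitrary, because the estimate covers every subset of
    the stages.\<close>
  have turnpike: "(\<Sum>i = nat \<lfloor>(1 - 1 / 2) * real (num_steps h t0 T)\<rfloor>..<num_steps h t0 T.
      h * ?\<alpha> (norm (\<psi> i - \<psi>\<sigma>) + norm (u i - u\<sigma>))) \<le> \<bar>A * B\<bar> + 1"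
    if "0 < h \<and> h < 1 / \<beta> \<and> t0 < T \<and> (T - t0) / h \<in> \<nat>"
      and opt: "optimal_pair P \<gamma> \<psi>bar h t0 T \<psi>0 \<psi> u" for h T \<psi> u
  proof -
    from that have h: "0 < h" "h < 1 / \<beta>"
      by auto
    obtain \<psi>' u' :: "nat \<Rightarrow> real^'d^'n" where "admissible P h t0 T \<psi>0 \<psi>' u'"
      and "cost \<gamma> \<psi>bar h t0 T \<psi>' u' \<le> B"
      unfolding B_def by (rule cheap_control[OF gamma_pos beta_pos h P_bounded])
    with opt have "cost \<gamma> \<psi>bar h t0 T \<psi> u \<le> B"
      unfolding optimal_pair_def by fastforce
    then have "A * cost \<gamma> \<psi>bar h t0 T \<psi> u \<le> A * B"
      using \<open>0 \<le> A\<close> by (rule mult_left_mono)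
    moreover have "(\<Sum>i = nat \<lfloor>(1 - 1 / 2) * real (num_steps h t0 T)\<rfloor>..<num_steps h t0 T.
        h * ?\<alpha> (norm (\<psi> i - \<psi>\<sigma>) + norm (u i - u\<sigma>))) \<le> A * cost \<gamma> \<psi>bar h t0 T \<psi> u"
      unfolding \<sigma> diff_zero A_def using gamma_pos h(1) by (rule sum_power2_le_cost) auto
    ultimately show ?thesis
      by linarith
  qed
  show "\<exists>(C1::real) (lam::real) (\<alpha> :: real \<Rightarrow> real).
          0 < C1 \<and> 0 < lam \<and> lam < 1 \<and>
          \<alpha> \<in> {0..} \<rightarrow> {0..} \<and> strict_mono_on {0..} \<alpha> \<and> \<alpha> 0 = 0 \<and>
          (\<forall>(h::real) (T::real).
             0 < h \<and> h < 1 / \<beta> \<and> t0 < T \<and> (T - t0) / h \<in> \<nat> \<longrightarrow>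
             (\<forall>\<psi> u. optimal_pair P \<gamma> \<psi>bar h t0 T \<psi>0 \<psi> u \<longrightarrow>
                (\<Sum>i = nat \<lfloor>(1 - lam) * real (num_steps h t0 T)\<rfloor>..<num_steps h t0 T.
                   h * \<alpha> (norm (\<psi> i - \<psi>\<sigma>) + norm (u i - u\<sigma>))) \<le> C1))"
  proof (rule exI[of _ "\<bar>A * B\<bar> + 1"], rule exI[of _ "1 / 2"], rule exI[of _ ?\<alpha>],
      intro conjI allI impI)
    show "strict_mono_on {0..} ?\<alpha>"
      by (auto intro!: strict_mono_onI power_strict_mono)
  qed (use turnpike in simp_all)
qed

end
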